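(* Let $G=(V,E,\vartheta,w)$ be a connected, locally finite, stochastically complete weighted graph with $D^{\epsilon}_{\vartheta}<\infty$, and let $\epsilon\in(0,1)$. Let $m: V\times(0,\infty)\to\mathbb{R}^+$ be a variable exponent, $\delta: V\times(0,\infty)\to\mathbb{R}$ a weight function, $b(x,u)$ and $\gamma(t)$ given real-valued functions, and suppose $u=u(x,t)>0$ is a solution on $V\times(0,\infty)$ of $$\Delta^{\epsilon}(u^{m(x,t)})-b(x,u)u=\delta(x,t)u_t+\gamma(t)u^{m(x,t)}.$$ Assume that $b(x,u)\le\varphi(x,t)u^{m(x,t)-1}$ for some function $\varphi: V\times(0,\infty)\to\mathbb{R}$, and that $\gamma(t)\le c_1+\frac{c_2}{t}$ for constants $c_1,c_2\in\mathbb{R}$. Then for any $x\in V$, $t>0$, and any function $\alpha(t)\ge 1$, $$\frac{2\Gamma^{\epsilon}(u^{\frac{m(x,t)}{2}})}{u^{m(x,t)}}-\alpha(t)\frac{\delta u_t}{u^{m(x,t)}}\le 2\alpha(t)D^{\epsilon}_{\vartheta}+\alpha(t)\varphi(x,t)+\alpha(t)\left(c_1+\frac{c_2}{t}\right).$$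
   Context: $G=(V,E,\vartheta,w)$ is a graph with vertex set $V$, edge set $E$, vertex measure $\vartheta:V\to(0,\infty)$ and symmetric edge weights $w_{xy}=w_{yx}>0$ if $x\sim y$ (adjacent), $w_{xy}=0$ otherwise. Locally finite: every vertex has finitely many neighbors. Let $p_t(x,y)$ be the heat kernel of $G$ (associated with $\Delta f(x)=\frac{1}{\vartheta(x)}\sum_{y\sim x}w_{xy}(f(y)-f(x))$). $G$ is stochastically complete if $\sum_{y\in V}p_t(x,y)\vartheta(y)=1$ for all $t>0$, $x\in V$. For $\epsilon\in(0,1)$ and $x\ne y$, $W_{\epsilon}(x,y)=\frac{\epsilon}{\Gamma(1-\epsilon)}\vartheta(x)\vartheta(y)\int_0^{\infty}p_t(x,y)t^{-1-\epsilon}\,dt$, where $\Gamma(1-\epsilon)$ is the Gamma function. For $f:V\to\mathbb{R}$, $$\Delta^{\epsilon}f(x)=\frac{1}{\vartheta(x)}\sum_{y\in V,\,y\ne x}W_{\epsilon}(x,y)(f(y)-f(x)),\qquad \Gamma^{\epsilon}(f)(x)=\frac{1}{2\vartheta(x)}\sum_{y\in V,\,y\ne x}W_{\epsilon}(x,y)(f(y)-f(x))^2.$$ $D^{\epsilon}_{\vartheta}:=\max_{x\in V}\frac{\sum_{y\in V,\,y\ne x}W_{\epsilon}(x,y)}{\vartheta(x)}$. Notation: for fixed $t$, $u^{m(x,t)}$ denotes the function $x\mapsto u(x,t)^{m(x,t)}$ on $V$, and $u^{m(x,t)/2}$ denotes $x\mapsto u(x,t)^{m(x,t)/2}$ (so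 the exponent is evaluated at the same vertex as $u$); operators act in the vertex variable. $u_t$ is the time derivative. *)

theory Defs
  imports "HOL-Analysis.Analysis"
begin

(* Adjacency is a symmetric relation on the vertices. Loops are not excluded; a loop weight
   never contributes to the Laplacian. *)
record 'v wgraph =
  verts :: "'v set"
  edges :: "('v \<times> 'v) set"
  meas :: "'v \<Rightarrow> real"
  wt :: "'v \<Rightarrow> 'v \<Rightarrow> real"

definition weighted_graph :: "'v wgraph \<Rightarrow> bool" where
  "weighted_graph G \<longleftrightarrow>
     edges G \<subseteq> verts G \<times> verts G \<and> sym (edges G) \<and>
     (\<forall>x\<in>verts G. meas G x > 0) \<and>
     (\<forall>x y. wt G x y = wt G y x) \<and>
     (\<forall>x y. (x, y) \<in> edges G \<longrightarrow> wt G x y > 0) \<and>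
     (\<forall>x y. (x, y) \<notin> edges G \<longrightarrow> wt G x y = 0)"

definition locally_finite_graph :: "'v wgraph \<Rightarrow> bool" where
  "locally_finite_graph G \<longleftrightarrow> (\<forall>x\<in>verts G. finite {y. (x, y) \<in> edges G})"

definition connected_graph :: "'v wgraph \<Rightarrow> bool" where
  "connected_graph G \<longleftrightarrow> (\<forall>x\<in>verts G. \<forall>y\<in>verts G. (x, y) \<in> (edges G)\<^sup>*)"

definition laplacian :: "'v wgraph \<Rightarrow> ('v \<Rightarrow> real) \<Rightarrow> 'v \<Rightarrow> real" where
  "laplacian G f x = 1 / meas G x * (\<Sum>y | (x, y) \<in> edges G. wt G x y * (f y - f x))"

(* The Laplacian with Dirichlet condition outside U. It is meant for functions that vanish
   outside U, a property it preserves. *)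
definition dirichlet_laplacian :: "'v wgraph \<Rightarrow> 'v set \<Rightarrow> ('v \<Rightarrow> real) \<Rightarrow> 'v \<Rightarrow> real" where
  "dirichlet_laplacian G U f x = (if x \<in> U then laplacian G f x else 0)"

(* For finite U: the kernel, with respect to the vertex measure, of the semigroup
   exp (t * dirichlet_laplacian G U), written as an exponential series. It is 0 unless
   both x and y are in U. *)
definition dirichlet_heat_kernel ::
    "'v wgraph \<Rightarrow> 'v set \<Rightarrow> real \<Rightarrow> 'v \<Rightarrow> 'v \<Rightarrow> real" where
  "dirichlet_heat_kernel G U t x y =
     (\<Sum>n. t ^ n / fact n * (dirichlet_laplacian G U ^^ n) (indicator ({y} \<inter> U)) x) / meas G y"

(* The (minimal) heat kernel obtained by exhaustion. Dirichlet heat kernels increase with the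
   domain and are bounded by 1 / meas G y, so the supremum over all finite sets of vertices is
   the limit along any exhaustion by finite sets. *)
definition heat_kernel :: "'v wgraph \<Rightarrow> real \<Rightarrow> 'v \<Rightarrow> 'v \<Rightarrow> real" where
  "heat_kernel G t x y =
     (SUP U \<in> {U. finite U \<and> U \<subseteq> verts G}. dirichlet_heat_kernel G U t x y)"

definition stochastically_complete :: "'v wgraph \<Rightarrow> bool" where
  "stochastically_complete G \<longleftrightarrow>
     (\<forall>t>0. \<forall>x\<in>verts G. ((\<lambda>y. heat_kernel G t x y * meas G y) has_sum 1) (verts G))"

(* Only used for x \<noteq> y, where the integral converges on a locally finite graph. *)
definition frac_weight :: "'v wgraph \<Rightarrow> real \<Rightarrow> 'v \<Rightarrow> 'v \<Rightarrow> real" where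
  "frac_weight G \<epsilon> x y =
     \<epsilon> / Gamma (1 - \<epsilon>) * meas G x * meas G y *
     (LBINT t:{0<..}. heat_kernel G t x y * t powr (- 1 - \<epsilon>))"

definition frac_laplacian :: "'v wgraph \<Rightarrow> real \<Rightarrow> ('v \<Rightarrow> real) \<Rightarrow> 'v \<Rightarrow> real" where
  "frac_laplacian G \<epsilon> f x =
     1 / meas G x * (\<Sum>\<^sub>\<infinity>y\<in>verts G - {x}. frac_weight G \<epsilon> x y * (f y - f x))"

(* Convergence of the series defining frac_laplacian; infsum is 0 on non-summable families. *)
definition frac_laplacian_converges :: "'v wgraph \<Rightarrow> real \<Rightarrow> ('v \<Rightarrow> real) \<Rightarrow> 'v \<Rightarrow> bool" where
  "frac_laplacian_converges G \<epsilon> f x \<longleftrightarrow>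
     (\<lambda>y. frac_weight G \<epsilon> x y * (f y - f x)) summable_on (verts G - {x})"

definition frac_gamma :: "'v wgraph \<Rightarrow> real \<Rightarrow> ('v \<Rightarrow> real) \<Rightarrow> 'v \<Rightarrow> real" where
  "frac_gamma G \<epsilon> f x =
     1 / (2 * meas G x) * (\<Sum>\<^sub>\<infinity>y\<in>verts G - {x}. frac_weight G \<epsilon> x y * (f y - f x)\<^sup>2)"

(* Extended-real valued, so that finiteness is a genuine condition on the sums and on the
   supremum. *)
definition frac_degree :: "'v wgraph \<Rightarrow> real \<Rightarrow> ennreal" where
  "frac_degree G \<epsilon> =
     (SUP x\<in>verts G.
        (\<Sum>\<^sub>\<infinity>y\<in>verts G - {x}. ennreal (frac_weight G \<epsilon> x y)) / ennreal (meas G x))"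

end

theory Submission
  imports Defs
begin

text \<open>
  Write \<open>v = u powr m\<close> and \<open>g = u powr (m / 2)\<close>, so that \<open>g\<^sup>2 = v\<close>. Expanding the square gives
  \<open>(g y - g x)\<^sup>2 = (v y - v x) + 2 * v x - 2 * g x * g y\<close>, and the last term has a favourable sign
  because \<open>g\<close> is positive. Summing against the nonnegative weights \<open>W x y\<close> bounds
  \<open>2 \<Gamma>(g) / v\<close> at \<open>x\<close> by \<open>\<Delta> v / v + 2 D\<close>
  (lemma \<open>frac_gamma_le_frac_laplacian_square\<close>). The equation for \<open>u\<close> replaces \<open>\<Delta> v / v\<close> by
  \<open>\<delta> u\<^sub>t / v + b u / v + \<gamma>\<close>, where \<open>b u / v \<le> \<phi>\<close> and \<open>\<gamma> \<le> c1 + c2 / t\<close>. This is the claim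
  for \<open>\<alpha> = 1\<close>; multiplication by \<open>\<alpha> \<ge> 1\<close> gives the general case, since \<open>\<Gamma>(g) \<ge> 0\<close>.

  What has to be earned is \<open>W \<ge> 0\<close>, that is, nonnegativity of the heat kernel
  (lemma \<open>heat_kernel_nonneg\<close>). The heat kernel is a supremum of real numbers, so comparing it with
  the Dirichlet kernel of the empty set, which vanishes, requires the Dirichlet kernels to be bounded
  above uniformly in the domain (lemma \<open>dirichlet_heat_kernel_le\<close>). That bound is obtained by
  uniformization: on a finite domain the Dirichlet Laplacian \<open>A\<close> becomes a positivity preserving
  operator \<open>B = A + c\<close> after adding a large constant \<open>c\<close>, and \<open>B\<close> multiplies the supremum norm by
  at most \<open>c\<close>. Hence \<open>exp (t A) = exp (- c t) exp (t B)\<close> does not increase the supremum norm.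
\<close>

section \<open>Exponential series of a shifted operator\<close>

text \<open>
  The binomial theorem for \<open>A = B - c\<close>, with \<open>a n k\<close> in the role of \<open>A ^ n B ^ k\<close>. Only the
  recursion is assumed, which allows its use for values of operator powers at a point.
\<close>
lemma binomial_expansion_of_recurrence:
  fixes a :: "nat \<Rightarrow> nat \<Rightarrow> 'a::comm_ring_1"
  assumes rec: "\<And>n k. a (Suc n) k = a n (Suc k) - c * a n k"
  shows "a n k = (\<Sum>j\<le>n. of_nat (n choose j) * (- c) ^ (n - j) * a 0 (k + j))"
proof (induction n arbitrary: k)
  case 0
  then show ?case by simp
next
  case (Suc n)
  let ?f = "\<lambda>j. (- c) ^ (Suc n - j) * a 0 (k + j)"
  have "(\<Sum>j\<le>Suc n. of_nat (Suc n choose j) * (- c) ^ (Suc n - j) * a 0 (k + j))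
      = ?f 0 + (\<Sum>j\<le>n. of_nat (Suc n choose Suc j) * ?f (Suc j))"
    by (subst sum.atMost_Suc_shift) (simp add: mult.assoc)
  also have "\<dots> = (\<Sum>j\<le>n. of_nat (n choose j) * ?f (Suc j))
      + (?f 0 + (\<Sum>j\<le>n. of_nat (n choose Suc j) * ?f (Suc j)))"
    by (simp add: algebra_simps sum.distrib)
  also have "?f 0 + (\<Sum>j\<le>n. of_nat (n choose Suc j) * ?f (Suc j))
      = (\<Sum>j\<le>Suc n. of_nat (n choose j) * ?f j)"
    by (subst sum.atMost_Suc_shift) simp
  also have "\<dots> = (\<Sum>j\<le>n. of_nat (n choose j) * ?f j)"
    by (simp add: binomial_eq_0)
  also have "\<dots> = (\<Sum>j\<le>n. - c * (of_nat (n choose j) * (- c) ^ (n - j) * a 0 (k + j)))"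
    by (rule sum.cong) (simp_all add: Suc_diff_le algebra_simps)
  also have "\<dots> = - c * a n k"
    by (simp only: Suc.IH[of k] sum_distrib_left)
  also have "(\<Sum>j\<le>n. of_nat (n choose j) * ?f (Suc j)) = a n (Suc k)"
    by (simp add: Suc.IH[of "Suc k"] mult.assoc)
  finally show ?case
    by (simp add: rec)
qed

text \<open>
  This is \<open>exp (t A) = exp (- c t) exp (t B)\<close> for \<open>A = B - c\<close>, read off as a Cauchy product.
\<close>
lemma exp_series_of_recurrence:
  fixes a :: "nat \<Rightarrow> nat \<Rightarrow> real"
  assumes rec: "\<And>n k. a (Suc n) k = a n (Suc k) - c * a n k"
    and summ: "summable (\<lambda>k. \<bar>t ^ k / fact k * a 0 k\<bar>)"
  shows "(\<Sum>n. t ^ n / fact n * a n 0) = exp (- (c * t)) * (\<Sum>k. t ^ k / fact k * a 0 k)"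
proof -
  let ?p = "\<lambda>k. t ^ k / fact k * a 0 k" and ?q = "\<lambda>k. (- (c * t)) ^ k / fact k"
  have q: "?q sums exp (- (c * t))"
    using exp_converges[of "- (c * t)"] by (simp add: field_simps)
  have qs: "summable (\<lambda>k. norm (?q k))"
    using summable_norm_exp[of "- (c * t)"] by (simp add: field_simps)
  have "(\<lambda>n. \<Sum>j\<le>n. ?p j * ?q (n - j)) sums ((\<Sum>k. ?p k) * (\<Sum>k. ?q k))"
    by (rule Cauchy_product_sums) (use summ qs in simp_all)
  moreover have "(\<Sum>j\<le>n. ?p j * ?q (n - j)) = t ^ n / fact n * a n 0" for n
  proof -
    have "?p j * ?q (n - j)
        = t ^ n / fact n * (of_nat (n choose j) * (- c) ^ (n - j) * a 0 (0 + j))"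
      if "j \<le> n" for j
    proof -
      have "t ^ n = t ^ j * t ^ (n - j)"
        using that by (simp flip: power_add)
      moreover have "(- (c * t)) ^ (n - j) = (- c) ^ (n - j) * t ^ (n - j)"
        by (metis minus_mult_left power_mult_distrib)
      ultimately show ?thesis
        by (simp add: binomial_fact[OF that])
    qed
    then show ?thesis
      unfolding binomial_expansion_of_recurrence[where a = a and c = c, OF rec, of n 0] sum_distrib_left
      by (intro sum.cong) auto
  qed
  ultimately show ?thesis
    using q by (simp add: sums_iff mult.commute)
qed

section \<open>Bounds for the heat kernel\<close>

lemma dirichlet_laplacian_diff_scale:
  "dirichlet_laplacian G U (\<lambda>x. f x - c * g x)
     = (\<lambda>x. dirichlet_laplacian G U f x - c * dirichlet_laplacian G U g x)"
proof
  fix x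
  have "(\<Sum>y | (x, y) \<in> edges G. wt G x y * (f y - c * g y - (f x - c * g x)))
      = (\<Sum>y | (x, y) \<in> edges G. wt G x y * (f y - f x))
        - c * (\<Sum>y | (x, y) \<in> edges G. wt G x y * (g y - g x))"
    unfolding sum_distrib_left sum_subtractf[symmetric]
    by (rule sum.cong) (simp_all add: algebra_simps)
  then show "dirichlet_laplacian G U (\<lambda>x. f x - c * g x) x
      = dirichlet_laplacian G U f x - c * dirichlet_laplacian G U g x"
    by (simp add: dirichlet_laplacian_def laplacian_def diff_divide_distrib)
qed

lemma dirichlet_laplacian_funpow_diff_scale:
  "(dirichlet_laplacian G U ^^ n) (\<lambda>x. f x - c * g x)
     = (\<lambda>x. (dirichlet_laplacian G U ^^ n) f x - c * (dirichlet_laplacian G U ^^ n) g x)"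
  by (induction n) (simp_all add: dirichlet_laplacian_diff_scale)

text \<open>
  Once \<open>c\<close> dominates the weighted degrees on \<open>U\<close>, the value of \<open>A f + c f\<close> at a vertex of \<open>U\<close> is a
  combination of values of \<open>f\<close> with nonnegative coefficients whose sum is \<open>c\<close>.
\<close>
lemma shifted_dirichlet_laplacian_bounds:
  fixes f :: "'v \<Rightarrow> real"
  assumes G: "weighted_graph G" and U: "U \<subseteq> verts G"
    and c: "c \<ge> 0" "\<And>x. x \<in> U \<Longrightarrow> (\<Sum>y | (x, y) \<in> edges G. wt G x y) / meas G x \<le> c"
    and f: "\<And>x. 0 \<le> f x" "\<And>x. f x \<le> K"
  shows "0 \<le> dirichlet_laplacian G U f x + c * f x"
    and "dirichlet_laplacian G U f x + c * f x \<le> c * K"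
proof -
  have cf: "0 \<le> c * f x" "c * f x \<le> c * K"
    using c f by (auto intro: mult_left_mono)
  have "0 \<le> dirichlet_laplacian G U f x + c * f x \<and>
      dirichlet_laplacian G U f x + c * f x \<le> c * K"
  proof (cases "x \<in> U")
    case False
    then show ?thesis using cf by (simp add: dirichlet_laplacian_def)
  next
    case True
    define d where "d = (\<Sum>y | (x, y) \<in> edges G. wt G x y) / meas G x"
    define s where "s = (\<Sum>y | (x, y) \<in> edges G. wt G x y * f y) / meas G x"
    have mx: "meas G x > 0"
      using G U True by (auto simp: weighted_graph_def)
    have w: "wt G x y \<ge> 0" if "(x, y) \<in> edges G" for y
      using G that by (force simp: weighted_graph_def)
    have A: "dirichlet_laplacian G U f x + c * f x = s + (c - d) * f x"
      using True
      by (simp add: dirichlet_laplacian_def laplacian_def s_def d_def right_diff_distrib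
          sum_subtractf sum_distrib_right[symmetric] diff_divide_distrib left_diff_distrib)
    have s0: "s \<ge> 0"
      unfolding s_def using mx w f by (intro divide_nonneg_pos sum_nonneg mult_nonneg_nonneg) auto
    have s1: "s \<le> d * K"
    proof -
      have "(\<Sum>y | (x, y) \<in> edges G. wt G x y * f y) \<le> (\<Sum>y | (x, y) \<in> edges G. wt G x y * K)"
        using w f by (intro sum_mono mult_left_mono) auto
      then show ?thesis
        using mx by (simp add: s_def d_def divide_right_mono sum_distrib_right)
    qed
    have "d \<le> c"
      using c(2)[OF True] by (simp add: d_def)
    then have "0 \<le> (c - d) * f x" "(c - d) * f x \<le> (c - d) * K"
      using f by (auto intro: mult_left_mono)
    then show ?thesis
      unfolding A using s0 s1 by (simp add: left_diff_distrib)
  qed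
  then show "0 \<le> dirichlet_laplacian G U f x + c * f x"
    and "dirichlet_laplacian G U f x + c * f x \<le> c * K" by auto
qed

text \<open>
  The Dirichlet semigroup is sub-Markovian: applied to a function bounded by 1, such as the
  indicator of a point, it stays bounded by 1. The proof uses uniformization with \<open>c\<close> the sum of
  the weighted degrees in \<open>U\<close>; the powers of \<open>B = A + c\<close> are then at most \<open>c ^ k\<close>, and
  the exponential series is at most \<open>exp (- c t) * exp (c t) = 1\<close>.
\<close>
lemma dirichlet_heat_kernel_le:
  assumes G: "weighted_graph G" and U: "finite U" "U \<subseteq> verts G"
    and y: "y \<in> verts G" and t: "t \<ge> 0"
  shows "dirichlet_heat_kernel G U t x y \<le> 1 / meas G y"
proof -
  define c where "c = (\<Sum>x\<in>U. (\<Sum>y | (x, y) \<in> edges G. wt G x y) / meas G x)"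
  have deg0: "0 \<le> (\<Sum>y | (x, y) \<in> edges G. wt G x y) / meas G x" if "x \<in> U" for x
  proof (intro divide_nonneg_pos sum_nonneg)
    show "meas G x > 0"
      using G U that by (auto simp: weighted_graph_def)
    show "wt G x z \<ge> 0" if "z \<in> {y. (x, y) \<in> edges G}" for z
      using G that by (force simp: weighted_graph_def)
  qed
  have c0: "c \<ge> 0"
    unfolding c_def by (intro sum_nonneg deg0)
  have c1: "(\<Sum>y | (x, y) \<in> edges G. wt G x y) / meas G x \<le> c" if "x \<in> U" for x
    unfolding c_def by (rule member_le_sum) (use that U deg0 in auto)
  define A where "A = dirichlet_laplacian G U"
  define B where "B = (\<lambda>(f :: 'a \<Rightarrow> real) z. A f z + c * f z)"
  define f0 :: "'a \<Rightarrow> real" where "f0 = indicator ({y} \<inter> U)"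
  define a where "a = (\<lambda>n k. (A ^^ n) ((B ^^ k) f0) x)"
  have bounds: "0 \<le> (B ^^ k) f0 z \<and> (B ^^ k) f0 z \<le> c ^ k" for k z
  proof (induction k arbitrary: z)
    case 0
    then show ?case by (simp add: f0_def indicator_def)
  next
    case (Suc k)
    then show ?case
      using shifted_dirichlet_laplacian_bounds[OF G U(2) c0 c1, of "(B ^^ k) f0" "c ^ k" z]
      by (simp add: B_def A_def)
  qed
  have rec: "a (Suc n) k = a n (Suc k) - c * a n k" for n k
  proof -
    have "A ((B ^^ k) f0) = (\<lambda>z. (B ^^ Suc k) f0 z - c * (B ^^ k) f0 z)"
      by (simp add: B_def)
    then show ?thesis
      by (simp add: a_def funpow_swap1 dirichlet_laplacian_funpow_diff_scale A_def
          funpow_Suc_right del: funpow.simps)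
  qed
  let ?p = "\<lambda>k. t ^ k / fact k * a 0 k"
  have p: "0 \<le> ?p k" "?p k \<le> (c * t) ^ k / fact k" for k
    using bounds[of k x] t
    by (auto simp: a_def power_mult_distrib mult.commute[of "t ^ k"] intro!: divide_right_mono mult_right_mono)
  have e: "(\<lambda>k. (c * t) ^ k / fact k) sums exp (c * t)"
    using exp_converges[of "c * t"] by (simp add: field_simps)
  have ps: "summable ?p"
    by (rule summable_comparison_test'[OF sums_summable[OF e], of 0])
      (use p in \<open>simp only: real_norm_def abs_of_nonneg\<close>)
  have "(\<Sum>k. ?p k) \<le> exp (c * t)"
    using suminf_le[OF p(2) ps sums_summable[OF e]] sums_unique[OF e] by simp
  then have "exp (- (c * t)) * (\<Sum>k. ?p k) \<le> exp (- (c * t)) * exp (c * t)"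
    by (intro mult_left_mono) auto
  also have "\<dots> = 1"
    by (simp flip: exp_add)
  finally have "exp (- (c * t)) * (\<Sum>k. ?p k) \<le> 1" .
  moreover have "(\<Sum>n. t ^ n / fact n * a n 0) = exp (- (c * t)) * (\<Sum>k. ?p k)"
  proof (rule exp_series_of_recurrence[where a = a and c = c, OF rec])
    show "summable (\<lambda>k. \<bar>?p k\<bar>)"
      using ps abs_of_nonneg[OF p(1)] by presburger
  qed
  moreover have "dirichlet_heat_kernel G U t x y = (\<Sum>n. t ^ n / fact n * a n 0) / meas G y"
    by (simp add: dirichlet_heat_kernel_def a_def A_def f0_def)
  moreover have "meas G y > 0"
    using G y by (simp add: weighted_graph_def)
  ultimately show ?thesis
    by (simp add: divide_right_mono)
qed

lemma dirichlet_heat_kernel_empty: "dirichlet_heat_kernel G {} t x y = 0"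
proof -
  have "(dirichlet_laplacian G {} ^^ n) (indicator {}) = (\<lambda>_. 0)" for n
    by (induction n) (auto simp: dirichlet_laplacian_def)
  then show ?thesis by (simp add: dirichlet_heat_kernel_def)
qed

lemma heat_kernel_nonneg:
  assumes "weighted_graph G" "y \<in> verts G" "t \<ge> 0"
  shows "0 \<le> heat_kernel G t x y"
proof -
  have "dirichlet_heat_kernel G {} t x y \<le> heat_kernel G t x y"
    unfolding heat_kernel_def
    by (rule cSUP_upper) (auto intro!: bdd_aboveI2[where M = "1 / meas G y"]
        dirichlet_heat_kernel_le assms)
  then show ?thesis by (simp add: dirichlet_heat_kernel_empty)
qed

section \<open>Fractional weights and the carre du champ\<close>

lemma frac_weight_nonneg:
  assumes G: "weighted_graph G" and xy: "x \<in> verts G" "y \<in> verts G" and \<epsilon>: "0 < \<epsilon>" "\<epsilon> < 1"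
  shows "0 \<le> frac_weight G \<epsilon> x y"
proof -
  have "0 \<le> (LBINT t:{0<..}. heat_kernel G t x y * t powr (- 1 - \<epsilon>))"
    unfolding set_lebesgue_integral_def
    by (rule Bochner_Integration.integral_nonneg)
      (auto simp: indicator_def intro!: mult_nonneg_nonneg heat_kernel_nonneg[OF G xy(2)])
  moreover have "meas G x > 0" "meas G y > 0"
    using G xy by (auto simp: weighted_graph_def)
  moreover have "Gamma (1 - \<epsilon>) > 0"
    using \<epsilon> by (intro Gamma_real_pos) simp
  ultimately show ?thesis
    using \<epsilon> unfolding frac_weight_def by (intro mult_nonneg_nonneg) auto
qed

text \<open>
  For nonnegative weights, finiteness of the extended-real degree gives real bounds on all finite
  partial sums, hence summability in the reals.
\<close>
lemma frac_weight_summable: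
  assumes G: "weighted_graph G" and x: "x \<in> verts G" and \<epsilon>: "0 < \<epsilon>" "\<epsilon> < 1"
    and D: "frac_degree G \<epsilon> < \<infinity>"
  shows "frac_weight G \<epsilon> x summable_on (verts G - {x})"
    and "(\<Sum>\<^sub>\<infinity>y\<in>verts G - {x}. frac_weight G \<epsilon> x y) \<le> meas G x * enn2real (frac_degree G \<epsilon>)"
proof -
  let ?W = "frac_weight G \<epsilon> x" and ?S = "verts G - {x}"
  have mx: "meas G x > 0"
    using G x by (simp add: weighted_graph_def)
  have W: "0 \<le> ?W y" if "y \<in> ?S" for y
    using frac_weight_nonneg[OF G x _ \<epsilon>] that by blast
  have fin: "sum ?W F \<le> meas G x * enn2real (frac_degree G \<epsilon>)" if F: "finite F" "F \<subseteq> ?S" for F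
  proof -
    have W0: "0 \<le> sum ?W F"
      using F W by (intro sum_nonneg) auto
    have "ennreal (sum ?W F / meas G x) = (\<Sum>y\<in>F. ennreal (?W y)) / ennreal (meas G x)"
      using F W W0 mx by (subst sum_ennreal) (auto simp: divide_ennreal)
    also have "(\<Sum>y\<in>F. ennreal (?W y)) \<le> (\<Sum>\<^sub>\<infinity>y\<in>?S. ennreal (?W y))"
      by (subst nonneg_infsum_complete) (use F in \<open>auto intro: SUP_upper\<close>)
    then have "(\<Sum>y\<in>F. ennreal (?W y)) / ennreal (meas G x)
        \<le> (\<Sum>\<^sub>\<infinity>y\<in>?S. ennreal (?W y)) / ennreal (meas G x)"
      by (rule divide_right_mono_ennreal)
    also have "\<dots> \<le> frac_degree G \<epsilon>"
      unfolding frac_degree_def by (rule SUP_upper[OF x])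
    finally have "enn2real (ennreal (sum ?W F / meas G x)) \<le> enn2real (frac_degree G \<epsilon>)"
      using D by (intro enn2real_mono) auto
    then show ?thesis
      using mx W0 by (simp add: field_simps)
  qed
  show s: "?W summable_on ?S"
    by (rule nonneg_bdd_above_summable_on) (use W fin in \<open>auto intro!: bdd_aboveI2\<close>)
  show "(\<Sum>\<^sub>\<infinity>y\<in>?S. ?W y) \<le> meas G x * enn2real (frac_degree G \<epsilon>)"
    by (rule infsum_le_finite_sums[OF s fin])
qed

lemma frac_gamma_nonneg:
  assumes "weighted_graph G" "x \<in> verts G" "0 < \<epsilon>" "\<epsilon> < 1"
  shows "0 \<le> frac_gamma G \<epsilon> g x"
proof -
  have "meas G x > 0"
    using assms by (simp add: weighted_graph_def)
  then show ?thesis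
    unfolding frac_gamma_def
    by (intro mult_nonneg_nonneg infsum_nonneg) (auto intro!: frac_weight_nonneg assms)
qed

text \<open>
  This is \<open>2 \<Gamma>(g) = \<Delta>(g\<^sup>2) - 2 g \<Delta> g\<close> together with \<open>- \<Delta> g \<le> D g\<close> for \<open>g \<ge> 0\<close>. To avoid
  discussing the convergence of \<open>\<Delta> g\<close>, both steps are combined into the termwise estimate
  \<open>(g y - g x)\<^sup>2 \<le> ((g y)\<^sup>2 - (g x)\<^sup>2) + 2 * (g x)\<^sup>2\<close>, whose right-hand side is summable
  against the weights. It also makes the series for \<open>\<Gamma>(g)\<close> converge.
\<close>
lemma frac_gamma_le_frac_laplacian_square:
  assumes G: "weighted_graph G" and x: "x \<in> verts G" and \<epsilon>: "0 < \<epsilon>" "\<epsilon> < 1"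
    and D: "frac_degree G \<epsilon> < \<infinity>"
    and g: "\<And>y. y \<in> verts G \<Longrightarrow> 0 \<le> g y"
    and conv: "frac_laplacian_converges G \<epsilon> (\<lambda>y. (g y)\<^sup>2) x"
  shows "2 * frac_gamma G \<epsilon> g x
      \<le> frac_laplacian G \<epsilon> (\<lambda>y. (g y)\<^sup>2) x + 2 * enn2real (frac_degree G \<epsilon>) * (g x)\<^sup>2"
proof -
  let ?W = "frac_weight G \<epsilon> x" and ?S = "verts G - {x}" and ?D = "enn2real (frac_degree G \<epsilon>)"
  let ?L = "\<lambda>y. ?W y * ((g y)\<^sup>2 - (g x)\<^sup>2)" and ?R = "\<lambda>y. ?W y * (2 * (g x)\<^sup>2)"
  have mx: "meas G x > 0"
    using G x by (simp add: weighted_graph_def)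
  have W: "0 \<le> ?W y" if "y \<in> ?S" for y
    using frac_weight_nonneg[OF G x _ \<epsilon>] that by blast
  have L: "?L summable_on ?S"
    using conv by (simp add: frac_laplacian_converges_def)
  note Ws = frac_weight_summable[OF G x \<epsilon> D]
  have R: "?R summable_on ?S"
    by (rule summable_on_cmult_left[OF Ws(1)])
  have term_le: "?W y * (g y - g x)\<^sup>2 \<le> ?L y + ?R y" if y: "y \<in> ?S" for y
  proof -
    have "0 \<le> g x * g y"
      using g x y by simp
    then have "(g y - g x)\<^sup>2 \<le> ((g y)\<^sup>2 - (g x)\<^sup>2) + 2 * (g x)\<^sup>2"
      by (simp add: power2_diff mult.commute)
    from mult_left_mono[OF this W[OF y]] show ?thesis
      by (simp only: distrib_left)
  qed
  have LR: "(\<lambda>y. ?L y + ?R y) summable_on ?S"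
    by (rule summable_on_add[OF L R])
  have "(\<lambda>y. ?W y * (g y - g x)\<^sup>2) summable_on ?S"
    by (rule summable_on_comparison_test[OF LR]) (use W term_le in auto)
  then have "(\<Sum>\<^sub>\<infinity>y\<in>?S. ?W y * (g y - g x)\<^sup>2) \<le> (\<Sum>\<^sub>\<infinity>y\<in>?S. ?L y + ?R y)"
    by (rule infsum_mono[OF _ LR term_le])
  also have "\<dots> = (\<Sum>\<^sub>\<infinity>y\<in>?S. ?L y) + (\<Sum>\<^sub>\<infinity>y\<in>?S. ?W y) * (2 * (g x)\<^sup>2)"
    by (simp only: infsum_add[OF L R] infsum_cmult_left[OF Ws(1)])
  also have "\<dots> \<le> (\<Sum>\<^sub>\<infinity>y\<in>?S. ?L y) + meas G x * ?D * (2 * (g x)\<^sup>2)"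
    using Ws(2) by (intro add_left_mono mult_right_mono) auto
  finally show ?thesis
    using mx by (simp add: frac_gamma_def frac_laplacian_def field_simps)
qed

section \<open>The gradient estimate\<close>

theorem theorem3p4:
  fixes G :: "'v wgraph" and \<epsilon> c1 c2 :: real
    and m \<delta> \<phi> u :: "'v \<Rightarrow> real \<Rightarrow> real"
    and b :: "'v \<Rightarrow> real \<Rightarrow> real"
    and \<gamma> \<alpha> :: "real \<Rightarrow> real"
  assumes "weighted_graph G" and "connected_graph G" and "locally_finite_graph G"
    and "stochastically_complete G"
    and "0 < \<epsilon>" and "\<epsilon> < 1"
    and "frac_degree G \<epsilon> < \<infinity>"
    and "\<And>x t. x \<in> verts G \<Longrightarrow> t > 0 \<Longrightarrow> m x t > 0"
    and "\<And>x t. x \<in> verts G \<Longrightarrow> t > 0 \<Longrightarrow> u x t > 0"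
    and "\<And>x t. x \<in> verts G \<Longrightarrow> t > 0 \<Longrightarrow> u x differentiable (at t)"
    and "\<And>x t. x \<in> verts G \<Longrightarrow> t > 0 \<Longrightarrow>
           frac_laplacian_converges G \<epsilon> (\<lambda>y. u y t powr m y t) x"
    and "\<And>x t. x \<in> verts G \<Longrightarrow> t > 0 \<Longrightarrow>
           frac_laplacian G \<epsilon> (\<lambda>y. u y t powr m y t) x - b x (u x t) * u x t
             = \<delta> x t * deriv (u x) t + \<gamma> t * u x t powr m x t"
    and "\<And>x t. x \<in> verts G \<Longrightarrow> t > 0 \<Longrightarrow> b x (u x t) \<le> \<phi> x t * u x t powr (m x t - 1)"
    and "\<And>t. t > 0 \<Longrightarrow> \<gamma> t \<le> c1 + c2 / t"
    and "\<And>t. t > 0 \<Longrightarrow> \<alpha> t \<ge> 1"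
  shows "\<forall>x\<in>verts G. \<forall>t>0.
           2 * frac_gamma G \<epsilon> (\<lambda>y. u y t powr (m y t / 2)) x / u x t powr m x t
             - \<alpha> t * (\<delta> x t * deriv (u x) t / u x t powr m x t)
           \<le> 2 * \<alpha> t * enn2real (frac_degree G \<epsilon>) + \<alpha> t * \<phi> x t + \<alpha> t * (c1 + c2 / t)"
proof (intro ballI allI impI)
  fix x t
  assume x: "x \<in> verts G" and t: "(0::real) < t"
  note G = assms(1) and \<epsilon> = assms(5,6) and D = assms(7)
  define g where "g = (\<lambda>y. u y t powr (m y t / 2))"
  define v where "v = u x t powr m x t"
  define S where "S = \<delta> x t * deriv (u x) t / v"
  have sq: "(g y)\<^sup>2 = u y t powr m y t" for y
    by (simp add: g_def power2_eq_square flip: powr_add)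
  have ux: "u x t > 0" and v: "v > 0"
    using assms(9)[OF x t] by (simp_all add: v_def)
  have "2 * frac_gamma G \<epsilon> g x
      \<le> frac_laplacian G \<epsilon> (\<lambda>y. (g y)\<^sup>2) x + 2 * enn2real (frac_degree G \<epsilon>) * (g x)\<^sup>2"
    by (rule frac_gamma_le_frac_laplacian_square[OF G x \<epsilon> D])
      (use assms(11)[OF x t] in \<open>simp_all add: sq, simp add: g_def\<close>)
  also have "frac_laplacian G \<epsilon> (\<lambda>y. (g y)\<^sup>2) x
      = b x (u x t) * u x t + \<delta> x t * deriv (u x) t + \<gamma> t * v"
    using assms(12)[OF x t] by (simp add: sq v_def)
  also have "b x (u x t) * u x t \<le> \<phi> x t * v"
  proof -
    have "b x (u x t) * u x t \<le> \<phi> x t * u x t powr (m x t - 1) * u x t"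
      using assms(13)[OF x t] ux by (intro mult_right_mono) auto
    also have "u x t powr (m x t - 1) * u x t = v"
      using ux by (simp add: v_def powr_diff)
    then have "\<phi> x t * u x t powr (m x t - 1) * u x t = \<phi> x t * v"
      by (simp add: mult.assoc)
    finally show ?thesis .
  qed
  also have "\<gamma> t * v \<le> (c1 + c2 / t) * v"
    using assms(14)[OF t] v by (intro mult_right_mono) auto
  finally have "2 * frac_gamma G \<epsilon> g x
      \<le> (\<phi> x t + S + (c1 + c2 / t) + 2 * enn2real (frac_degree G \<epsilon>)) * v"
    using v by (simp add: sq S_def distrib_right flip: v_def)
  then have main: "2 * frac_gamma G \<epsilon> g x / v
      \<le> \<phi> x t + S + (c1 + c2 / t) + 2 * enn2real (frac_degree G \<epsilon>)"
    using v by (simp only: pos_divide_le_eq)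
  have \<alpha>: "\<alpha> t \<ge> 1"
    using assms(15)[OF t] .
  have "0 \<le> 2 * frac_gamma G \<epsilon> g x / v"
    using frac_gamma_nonneg[OF G x \<epsilon>, of g] v by simp
  then have "2 * frac_gamma G \<epsilon> g x / v \<le> \<alpha> t * (2 * frac_gamma G \<epsilon> g x / v)"
    using \<alpha> mult_right_mono[of 1 "\<alpha> t"] by fastforce
  also have "\<dots> \<le> \<alpha> t * (\<phi> x t + S + (c1 + c2 / t) + 2 * enn2real (frac_degree G \<epsilon>))"
    using main \<alpha> by (intro mult_left_mono) auto
  finally show "2 * frac_gamma G \<epsilon> (\<lambda>y. u y t powr (m y t / 2)) x / u x t powr m x t
      - \<alpha> t * (\<delta> x t * deriv (u x) t / u x t powr m x t)
      \<le> 2 * \<alpha> t * enn2real (frac_degree G \<epsilon>) + \<alpha> t * \<phi> x t + \<alpha> t * (c1 + c2 / t)"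
    unfolding g_def[symmetric] v_def[symmetric] S_def[symmetric] by (simp add: distrib_left)
qed

end
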